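(* Let $d>0$ be a real number and let $G$ be a (finite, simple, nonempty) spectrally $d$-degenerate graph. Then $G$ contains a vertex whose degree is at most $\max\{4d,\,4d\log_2(\Delta(G)/d)\}$.
   Context: All graphs are finite and simple (no loops or multiple edges). $\Delta(G)$ is the maximum degree of $G$; $\rho(G)$ is the spectral radius of $G$, i.e. the largest eigenvalue of its adjacency matrix. A graph $G$ is spectrally $d$-degenerate if every subgraph $H\subseteq G$ satisfies $\rho(H)\le\sqrt{d\,\Delta(H)}$. If $\Delta(G)=0$, then $\log_2(\Delta(G)/d)$ is read as $-\infty$, so that the bound is $4d$. *)

theory Defs
  imports
    Complex_Main
    "Graph_Theory.Digraph_Component"
    "Jordan_Normal_Form.Spectral_Radius"
begin

text \<open>
  A finite simple graph is a \<^locale>\<open>pair_graph\<close>: an undirected edge \<open>uv\<close> is represented by the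
  two arcs \<open>(u,v)\<close> and \<open>(v,u)\<close>, so \<^const>\<open>out_degree\<close> is the usual vertex degree.
\<close>

abbreviation degree_of :: "'a pair_pre_digraph \<Rightarrow> 'a \<Rightarrow> nat" where
  "degree_of G v \<equiv> out_degree (with_proj G) v"

text \<open>For graphs with at least one vertex only.\<close>
definition max_degree :: "'a pair_pre_digraph \<Rightarrow> nat" where
  "max_degree G = Max (degree_of G ` pverts G)"

definition adjacency_matrix :: "'a list \<Rightarrow> 'a pair_pre_digraph \<Rightarrow> real mat" where
  "adjacency_matrix vs G =
     mat (length vs) (length vs) (\<lambda>(i, j). if (vs ! i, vs ! j) \<in> parcs G then 1 else 0)"

definition vertex_list :: "'a pair_pre_digraph \<Rightarrow> 'a list" where
  "vertex_list G = (SOME vs. distinct vs \<and> set vs = pverts G)"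

text \<open>
  The largest eigenvalue of the adjacency matrix, for graphs with at least one vertex only.
  The rows and columns are indexed by an arbitrary enumeration of the vertices; by
  \<open>spectrum_adjacency_matrix_cong\<close> below the spectrum does not depend on it.  The matrix is
  real symmetric, so all of its eigenvalues are real.
\<close>
definition graph_spectral_radius :: "'a pair_pre_digraph \<Rightarrow> real" where
  "graph_spectral_radius G = Max (spectrum (adjacency_matrix (vertex_list G) G))"

text \<open>
  The subgraphs are the \<^const>\<open>subgraph\<close>s that are again symmetric, i.e. undirected.  The null graph
  is left out, since its maximum degree and spectral radius are not defined.
\<close>
definition spectrally_degenerate :: "real \<Rightarrow> 'a pair_pre_digraph \<Rightarrow> bool" where
  "spectrally_degenerate d G \<longleftrightarrow>
     (\<forall>H. pair_graph H \<and> pverts H \<noteq> {} \<and> subgraph (with_proj H) (with_proj G) \<longrightarrow>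
        graph_spectral_radius H \<le> sqrt (d * real (max_degree H)))"

lemma vertex_list:
  assumes "finite (pverts G)"
  shows "distinct (vertex_list G)" "set (vertex_list G) = pverts G"
proof -
  have "\<exists>vs. distinct vs \<and> set vs = pverts G"
    using finite_distinct_list[OF assms] by blast
  from someI_ex[OF this] show "distinct (vertex_list G)" "set (vertex_list G) = pverts G"
    by (simp_all add: vertex_list_def)
qed

lemma eigenvalue_adjacency_matrix_iff:
  assumes "distinct vs"
  shows "eigenvalue (adjacency_matrix vs G) k \<longleftrightarrow>
    (\<exists>f. (\<exists>v\<in>set vs. f v \<noteq> 0) \<and>
       (\<forall>u\<in>set vs. (\<Sum>v\<in>set vs. if (u, v) \<in> parcs G then f v else 0) = k * f u))"
    (is "?L \<longleftrightarrow> ?R")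
proof -
  let ?n = "length vs"
  have sum_eq: "(\<Sum>j<?n. g (vs ! j)) = (\<Sum>v\<in>set vs. g v)" for g :: "'a \<Rightarrow> real"
    by (rule sum.reindex_bij_betw) (rule bij_betw_nth[OF assms refl refl])
  have mv: "(adjacency_matrix vs G *\<^sub>v x) $ i =
      (\<Sum>j<?n. if (vs ! i, vs ! j) \<in> parcs G then x $ j else 0)"
    if "i < ?n" "x \<in> carrier_vec ?n" for i x
    using that by (auto simp: adjacency_matrix_def scalar_prod_def lessThan_atLeast0 intro!: sum.cong)
  have dim: "dim_row (adjacency_matrix vs G) = ?n"
    by (simp add: adjacency_matrix_def)
  show ?thesis
  proof
    assume ?L
    then obtain x where x: "x \<in> carrier_vec ?n" "x \<noteq> 0\<^sub>v ?n"
      and ev: "adjacency_matrix vs G *\<^sub>v x = k \<cdot>\<^sub>v x"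
      by (auto simp: eigenvalue_def eigenvector_def dim)
    define f where "f v = x $ (the_inv_into {..<?n} ((!) vs) v)" for v
    have inj: "inj_on ((!) vs) {..<?n}"
      using bij_betw_nth[OF assms refl refl] by (auto simp: bij_betw_def)
    have f: "f (vs ! i) = x $ i" if "i < ?n" for i
      using the_inv_into_f_f[OF inj] that by (simp add: f_def)
    from x obtain i where i: "i < ?n" "x $ i \<noteq> 0"
      by (metis carrier_vecD eq_vecI index_zero_vec)
    have "\<exists>v\<in>set vs. f v \<noteq> 0"
      using i f[of i] by (metis nth_mem)
    moreover have "(\<Sum>v\<in>set vs. if (u, v) \<in> parcs G then f v else 0) = k * f u"
      if "u \<in> set vs" for u
    proof -
      from that obtain i where i: "i < ?n" "u = vs ! i" by (metis in_set_conv_nth)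
      have "(\<Sum>v\<in>set vs. if (u, v) \<in> parcs G then f v else 0)
          = (\<Sum>j<?n. if (vs ! i, vs ! j) \<in> parcs G then x $ j else 0)"
        unfolding i(2) by (subst sum_eq[symmetric]) (auto simp: f intro!: sum.cong)
      also have "\<dots> = (k \<cdot>\<^sub>v x) $ i" using mv[OF i(1) x(1)] ev by simp
      also have "\<dots> = k * f u" using i x(1) by (simp add: f)
      finally show ?thesis .
    qed
    ultimately show ?R by blast
  next
    assume ?R
    then obtain f v where v: "v \<in> set vs" "f v \<noteq> 0"
      and ev: "\<And>u. u \<in> set vs \<Longrightarrow>
        (\<Sum>v\<in>set vs. if (u, v) \<in> parcs G then f v else 0) = k * f u" by blast
    define x where "x = vec ?n (\<lambda>i. f (vs ! i))"
    have x: "x \<in> carrier_vec ?n" by (simp add: x_def)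
    from v obtain i where "i < ?n" "v = vs ! i" by (metis in_set_conv_nth)
    then have "x \<noteq> 0\<^sub>v ?n" using v
      by (metis index_vec index_zero_vec(1) x_def)
    moreover have "adjacency_matrix vs G *\<^sub>v x = k \<cdot>\<^sub>v x"
    proof (rule eq_vecI)
      fix i assume "i < dim_vec (k \<cdot>\<^sub>v x)"
      then have i: "i < ?n" by (simp add: x_def)
      have "(adjacency_matrix vs G *\<^sub>v x) $ i
          = (\<Sum>j<?n. if (vs ! i, vs ! j) \<in> parcs G then f (vs ! j) else 0)"
        unfolding mv[OF i x] by (auto simp: x_def intro!: sum.cong)
      also have "\<dots> = k * f (vs ! i)"
        by (subst sum_eq) (use ev i in auto)
      finally show "(adjacency_matrix vs G *\<^sub>v x) $ i = (k \<cdot>\<^sub>v x) $ i"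
        using i by (simp add: x_def)
    qed (simp add: x_def dim)
    ultimately show ?L using x by (auto simp: eigenvalue_def eigenvector_def dim)
  qed
qed

lemma spectrum_adjacency_matrix_cong:
  assumes "distinct vs" "distinct ws" "set vs = set ws"
  shows "spectrum (adjacency_matrix vs G) = spectrum (adjacency_matrix ws G)"
  unfolding spectrum_def
  by (rule Collect_cong)
    (simp only: eigenvalue_adjacency_matrix_iff[OF assms(1)] eigenvalue_adjacency_matrix_iff[OF assms(2)] assms(3))

end

theory Submission
  imports Defs "HOL-Analysis.Function_Topology"
begin

text \<open>
  Suppose that all degrees exceed the bound, let \<open>m\<close> be the least integer exceeding it, and pass to an
  edge-minimal spanning subgraph of minimum degree at least \<open>m\<close>.  Every edge then has an end in the
  set \<open>A\<close> of vertices of degree exactly \<open>m\<close>.  Testing the spectral radius of the subgraph induced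
  on \<open>A\<close> shows that \<open>A\<close> spans few edges.  The other vertices fall into dyadic degree classes, and
  the bipartite graph between one class and \<open>A\<close> has nearly regular degrees on the class side and
  smaller ones on the side of \<open>A\<close>, so a two-valued test vector shows that it has at most \<open>2d|A|\<close>
  edges.  With \<open>k\<close> classes, counting the degrees in \<open>A\<close> gives \<open>m \<le> \<surd>(dm) + 2dk \<le> m/2 + 2dk\<close>,
  while \<open>k < log\<^sub>2 (\<Delta>/d)\<close> because \<open>m > 4d\<close>.
\<close>

section \<open>The Rayleigh principle for symmetric forms on a finite set\<close>

text \<open>Pinning functions to 0 off \<open>S\<close> and to \<open>{-1..1}\<close> on it yields a
  product of compact sets, and the sphere equation cuts out a closed part of it.\<close>

lemma compact_unit_sphere_fun:
  fixes S :: "'a set"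
  shows "compact {x :: 'a \<Rightarrow> real. (\<forall>i. x i \<in> (if i \<in> S then {-1..1} else {0})) \<and> (\<Sum>i\<in>S. (x i)\<^sup>2) = 1}"
proof -
  let ?I = "\<lambda>i. if i \<in> S then {-1..1} else {0 :: real}"
  have "compact (PiE UNIV ?I)"
    using compactin_PiE[of "\<lambda>_. euclidean" UNIV ?I]
    by (simp add: euclidean_product_topology)
  moreover have "closed {x :: 'a \<Rightarrow> real. (\<Sum>i\<in>S. (x i)\<^sup>2) = 1}"
    by (intro closed_Collect_eq continuous_intros continuous_on_product_coordinates)
  ultimately have "compact (PiE UNIV ?I \<inter> {x. (\<Sum>i\<in>S. (x i)\<^sup>2) = 1})"
    by (rule compact_Int_closed)
  then show ?thesis
    by (simp add: PiE_UNIV_domain Collect_conj_eq Pi_def cong: if_cong)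
qed

lemma quadratic_nonneg_imp_linear_coeff_eq_0:
  fixes b c :: real
  assumes "\<And>t. 0 \<le> 2 * t * b + t\<^sup>2 * c"
  shows "b = 0"
proof -
  \<comment> \<open>At \<open>t = - b / s\<close> the linear term outweighs the quadratic one as
    soon as \<open>s > 0\<close> and \<open>c < 2 * s\<close>. This choice meets both, whatever the
    sign of \<open>c\<close>.\<close>
  define s where "s = 1 + \<bar>c\<bar>"
  have s: "s > 0" "c < s" by (auto simp: s_def)
  have "0 \<le> 2 * (- b / s) * b + (- b / s)\<^sup>2 * c" by (rule assms)
  also have "\<dots> = (b\<^sup>2 / s) * (c / s - 2)"
    using s by (simp add: power2_eq_square field_simps)
  finally have "0 \<le> (b\<^sup>2 / s) * (c / s - 2)" .
  moreover have "c / s - 2 < 0" using s by (simp add: field_simps)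
  ultimately have "b\<^sup>2 / s \<le> 0"
    by (metis linorder_not_less mult_pos_neg)
  then show ?thesis using s by (simp add: divide_le_0_iff)
qed

text \<open>A maximiser of the form on the unit sphere is an eigenvector, and the maximum is its
  eigenvalue; homogeneity carries the bound to all \<open>x\<close>.\<close>

lemma symmetric_form_eigenvalue_bound:
  fixes a :: "'a \<Rightarrow> 'a \<Rightarrow> real"
  assumes S: "finite S" "S \<noteq> {}" and sym: "\<And>u v. a u v = a v u"
  shows "\<exists>f \<mu>. (\<exists>v\<in>S. f v \<noteq> 0) \<and> (\<forall>u\<in>S. (\<Sum>v\<in>S. a u v * f v) = \<mu> * f u) \<and>
    (\<forall>x. (\<Sum>u\<in>S. \<Sum>v\<in>S. a u v * x u * x v) \<le> \<mu> * (\<Sum>v\<in>S. (x v)\<^sup>2))"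
proof -
  define Q where "Q x = (\<Sum>u\<in>S. \<Sum>v\<in>S. a u v * x u * x v)" for x
  define N where "N x = (\<Sum>v\<in>S. (x v)\<^sup>2)" for x :: "'a \<Rightarrow> real"
  define K where "K = {x :: 'a \<Rightarrow> real. (\<forall>i. x i \<in> (if i \<in> S then {-1..1} else {0})) \<and> (\<Sum>i\<in>S. (x i)\<^sup>2) = 1}"
  obtain s where s: "s \<in> S" using S by blast
  define \<delta> where "\<delta> i = (if i = s then 1 else 0 :: real)" for i
  have "\<delta> \<in> K"
    using S s by (auto simp: K_def \<delta>_def if_distrib[of "\<lambda>t. t\<^sup>2"] cong: if_cong)
  then have "K \<noteq> {}" by blast
  moreover have "continuous_on K Q"
    unfolding Q_def by (intro continuous_intros continuous_on_subset[OF continuous_on_product_coordinates] subset_UNIV)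
  ultimately obtain f where f: "f \<in> K" and max: "\<And>y. y \<in> K \<Longrightarrow> Q y \<le> Q f"
    using continuous_attains_sup[OF compact_unit_sphere_fun[of S, folded K_def]] by blast
  define \<mu> where "\<mu> = Q f"
  have Nf: "N f = 1" using f by (simp add: N_def K_def)
  \<comment> \<open>Both sides are homogeneous of degree 2, so \<open>x\<close> may be scaled to
    norm 1. The scaled function is reset to 0 off \<open>S\<close>, as membership in
    \<open>K\<close> demands.\<close>
  have bound: "Q x \<le> \<mu> * N x" for x
  proof (cases "N x = 0")
    case True
    then have "x v = 0" if "v \<in> S" for v
      using that S by (simp add: N_def sum_nonneg_eq_0_iff)
    then show ?thesis using True by (simp add: Q_def)
  next
    case False
    moreover have "0 \<le> N x" unfolding N_def by (intro sum_nonneg) simp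
    ultimately have pos: "N x > 0" by simp
    define r where "r = sqrt (N x)"
    have r: "r > 0" "r\<^sup>2 = N x" using pos by (simp_all add: r_def)
    define y where "y v = (if v \<in> S then x v / r else 0)" for v
    have "-1 \<le> x v / r \<and> x v / r \<le> 1" if "v \<in> S" for v
    proof -
      have "(x v)\<^sup>2 \<le> r\<^sup>2"
        unfolding r(2) N_def using that S(1) by (intro member_le_sum) auto
      then have "\<bar>x v\<bar> \<le> r" using r(1) by (simp add: abs_le_square_iff[symmetric])
      then show ?thesis using r(1) by (auto simp: field_simps abs_le_iff)
    qed
    moreover have "(\<Sum>v\<in>S. (y v)\<^sup>2) = (\<Sum>v\<in>S. (x v)\<^sup>2) / r\<^sup>2"
      unfolding sum_divide_distrib by (rule sum.cong) (auto simp: y_def power_divide)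
    ultimately have "y \<in> K"
      using r pos by (auto simp: K_def y_def N_def)
    then have "Q y \<le> \<mu>" unfolding \<mu>_def by (rule max)
    also have "Q y = Q x / r\<^sup>2"
      unfolding Q_def sum_divide_distrib
      by (intro sum.cong refl) (simp add: y_def power2_eq_square)
    finally show ?thesis using pos r(2) by (simp add: field_simps)
  qed
  \<comment> \<open>The form \<open>\<mu> * N x - Q x\<close> is nonnegative and vanishes at \<open>f\<close>, so its derivative there is zero.\<close>
  have "(\<Sum>v\<in>S. a u v * f v) = \<mu> * f u" if u: "u \<in> S" for u
  proof -
    define e where "e v = (if v = u then 1 else 0 :: real)" for v
    define g where "g = (\<Sum>v\<in>S. a u v * f v)"
    \<comment> \<open>Symmetry of \<open>a\<close> makes both cross terms equal to
      \<open>g\<close>.\<close>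
    have Qt: "Q (\<lambda>v. f v + t * e v) = \<mu> + 2 * t * g + t\<^sup>2 * Q e" for t
    proof -
      have "Q (\<lambda>v. f v + t * e v) = Q f
          + t * (\<Sum>w\<in>S. \<Sum>v\<in>S. a w v * f w * e v) + t * (\<Sum>w\<in>S. \<Sum>v\<in>S. a w v * e w * f v)
          + t\<^sup>2 * Q e"
        by (simp add: Q_def algebra_simps sum.distrib sum_distrib_left power2_eq_square)
      also have "(\<Sum>w\<in>S. \<Sum>v\<in>S. a w v * f w * e v) = g"
        using S u by (simp add: e_def g_def if_distrib sum.delta sym[of _ u] cong: if_cong)
      also have "(\<Sum>w\<in>S. \<Sum>v\<in>S. a w v * e w * f v) = (\<Sum>w\<in>S. if w = u then g else 0)"
        by (rule sum.cong) (auto simp: e_def g_def)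
      also have "\<dots> = g" using S u by simp
      finally show ?thesis by (simp add: \<mu>_def)
    qed
    have "N (\<lambda>v. f v + t * e v) = N f + 2 * t * (\<Sum>v\<in>S. f v * e v) + t\<^sup>2 * (\<Sum>v\<in>S. (e v)\<^sup>2)" for t
      by (simp add: N_def power2_eq_square algebra_simps sum.distrib sum_distrib_left)
    moreover have "(\<Sum>v\<in>S. f v * e v) = f u" "(\<Sum>v\<in>S. (e v)\<^sup>2) = 1"
      using S u by (simp_all add: e_def if_distrib[of "\<lambda>t. t\<^sup>2"] if_distrib[of "\<lambda>t. _ * t"] cong: if_cong)
    ultimately have Nt: "N (\<lambda>v. f v + t * e v) = 1 + 2 * t * f u + t\<^sup>2" for t
      using Nf by simp
    have "0 \<le> 2 * t * (\<mu> * f u - g) + t\<^sup>2 * (\<mu> - Q e)" for t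
      using bound[of "\<lambda>v. f v + t * e v"] unfolding Qt Nt by (simp add: algebra_simps)
    then have "\<mu> * f u - g = 0" by (rule quadratic_nonneg_imp_linear_coeff_eq_0)
    then show ?thesis by (simp add: g_def)
  qed
  moreover have "\<exists>v\<in>S. f v \<noteq> 0"
    using Nf by (metis (no_types, lifting) N_def power_zero_numeral sum.neutral zero_neq_one)
  ultimately show ?thesis
    using bound unfolding Q_def N_def by blast
qed

section \<open>Quadratic forms of subgraphs\<close>

text \<open>The sum over arcs is the quadratic form of the adjacency matrix. The eigenvalue bounding
  it lies in the finite spectrum, hence below the maximum.\<close>

lemma quadratic_form_le_graph_spectral_radius:
  assumes "pair_graph H" "pverts H \<noteq> {}"
  shows "(\<Sum>(u, v)\<in>parcs H. x u * x v) \<le> graph_spectral_radius H * (\<Sum>v\<in>pverts H. (x v)\<^sup>2)"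
proof -
  interpret pair_graph H by fact
  let ?S = "pverts H" and ?M = "adjacency_matrix (vertex_list H) H"
  define a where "a u v = (if (u, v) \<in> parcs H then 1 else 0 :: real)" for u v
  have a_sym: "a u v = a v u" for u v
    using pair_sym_arcs by (auto simp: a_def symmetric_def sym_def)
  obtain f \<mu> where f: "\<exists>v\<in>?S. f v \<noteq> 0" "\<forall>u\<in>?S. (\<Sum>v\<in>?S. a u v * f v) = \<mu> * f u"
    and bound: "\<forall>x. (\<Sum>u\<in>?S. \<Sum>v\<in>?S. a u v * x u * x v) \<le> \<mu> * (\<Sum>v\<in>?S. (x v)\<^sup>2)"
    using symmetric_form_eigenvalue_bound[of ?S a, OF pair_finite_verts assms(2) a_sym] by blast
  note vl = vertex_list[OF pair_finite_verts]
  have "eigenvalue ?M \<mu>"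
    unfolding eigenvalue_adjacency_matrix_iff[OF vl(1)] vl(2)
    using f by (intro exI[of _ f]) (simp add: a_def if_distrib[of "\<lambda>t. t * _"] cong: if_cong)
  moreover have "?M \<in> carrier_mat (length (vertex_list H)) (length (vertex_list H))"
    by (simp add: adjacency_matrix_def)
  ultimately have "\<mu> \<le> graph_spectral_radius H"
    unfolding graph_spectral_radius_def
    by (intro Max_ge card_finite_spectrum) (auto simp: spectrum_def)
  have sub: "parcs H \<subseteq> ?S \<times> ?S" using in_arcsD1 in_arcsD2 by auto
  have "(\<Sum>u\<in>?S. \<Sum>v\<in>?S. a u v * x u * x v) = (\<Sum>(u, v)\<in>?S \<times> ?S. a u v * x u * x v)"
    by (rule sum.cartesian_product)
  also have "\<dots> = (\<Sum>(u, v)\<in>parcs H. a u v * x u * x v)"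
    by (rule sum.mono_neutral_right) (use sub pair_finite_verts in \<open>auto simp: a_def\<close>)
  also have "\<dots> = (\<Sum>(u, v)\<in>parcs H. x u * x v)"
    by (rule sum.cong) (auto simp: a_def)
  finally have "(\<Sum>(u, v)\<in>parcs H. x u * x v) \<le> \<mu> * (\<Sum>v\<in>?S. (x v)\<^sup>2)"
    using bound[rule_format, of x] by (rule ord_eq_le_trans[OF sym])
  also have "\<dots> \<le> graph_spectral_radius H * (\<Sum>v\<in>?S. (x v)\<^sup>2)"
    by (intro mult_right_mono sum_nonneg) (use \<open>\<mu> \<le> _\<close> in auto)
  finally show ?thesis .
qed

lemma degree_of_eq_card_Image: "degree_of G v = card (parcs G `` {v})"
proof -
  have "out_arcs (with_proj G) v = Pair v ` (parcs G `` {v})"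
    by (auto simp: out_arcs_def)
  then show ?thesis by (simp add: out_degree_def card_image inj_on_def)
qed

text \<open>This is the form in which degeneracy is applied: a subgraph is given by a vertex set and
  a symmetric arc set, and any bound \<open>D\<close> on its degrees may replace the maximum
  degree.\<close>

lemma spectrally_degenerate_quadratic_form:
  assumes G: "pair_graph G" "spectrally_degenerate d G" and "d \<ge> 0"
    and V: "V \<subseteq> pverts G" "V \<noteq> {}" and E: "E \<subseteq> parcs G" "E \<subseteq> V \<times> V" "sym E"
    and D: "\<And>v. v \<in> V \<Longrightarrow> real (card (E `` {v})) \<le> D"
  shows "(\<Sum>(u, v)\<in>E. x u * x v) \<le> sqrt (d * D) * (\<Sum>v\<in>V. (x v)\<^sup>2)"
proof -
  interpret pair_graph G by fact
  define H where "H = \<lparr>pverts = V, parcs = E\<rparr>"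
  have H: "pverts H = V" "parcs H = E" by (simp_all add: H_def)
  have fin: "finite V" using V pair_finite_verts finite_subset by blast
  have "pair_graph H"
  proof
    show "finite (parcs H)" using E(1) pair_finite_arcs finite_subset H by metis
    show "symmetric (with_proj H)" using E(3) by (simp add: symmetric_def H)
  qed (use fin E pair_no_loops in \<open>auto simp: H\<close>)
  moreover from this interpret H: pair_graph H .
  have "subgraph (with_proj H) (with_proj G)"
    using V E wf_digraph_axioms H.wf_digraph_axioms by (simp add: subgraph_def compatible_def H)
  ultimately have "graph_spectral_radius H \<le> sqrt (d * real (max_degree H))"
    using G(2) V(2) by (simp add: spectrally_degenerate_def H)
  also have "real (max_degree H) \<le> D"
  proof -
    have "max_degree H \<in> degree_of H ` V"
      unfolding max_degree_def H using fin V(2) by (intro Max_in) auto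
    then show ?thesis using D by (auto simp: degree_of_eq_card_Image H)
  qed
  then have "sqrt (d * real (max_degree H)) \<le> sqrt (d * D)"
    using \<open>d \<ge> 0\<close> by (simp add: mult_left_mono)
  finally have le: "graph_spectral_radius H \<le> sqrt (d * D)" .
  have "(\<Sum>(u, v)\<in>E. x u * x v) \<le> graph_spectral_radius H * (\<Sum>v\<in>V. (x v)\<^sup>2)"
    using quadratic_form_le_graph_spectral_radius[OF \<open>pair_graph H\<close>] V(2) by (simp add: H)
  also have "\<dots> \<le> sqrt (d * D) * (\<Sum>v\<in>V. (x v)\<^sup>2)"
    by (intro mult_right_mono le sum_nonneg) auto
  finally show ?thesis .
qed

lemma card_rel_eq_sum_Image:
  assumes "finite W" "finite F" "Domain F \<subseteq> W"
  shows "card F = (\<Sum>w\<in>W. card (F `` {w}))"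
proof -
  have "F = (SIGMA w:W. F `` {w})" using assms(3) by auto
  moreover have "card (SIGMA w:W. F `` {w}) = (\<Sum>w\<in>W. card (F `` {w}))"
    using assms by (intro card_SigmaI) (auto simp: finite_Image)
  ultimately show ?thesis by simp
qed

section \<open>Sparsity of bipartite subgraphs that are nearly regular on one side\<close>

text \<open>With \<open>c = sqrt (d / D)\<close> and weights 1 on \<open>W\<close> and
  \<open>2 * c\<close> on \<open>A\<close>, the form gives
  \<open>4 * card F \<le> card W * D + 4 * d * card A\<close>. As
  \<open>card W * D \<le> 2 * card F\<close>, half of the left side absorbs the \<open>W\<close>
  term.\<close>

lemma spectrally_degenerate_bipartite_card:
  assumes G: "pair_graph G" "spectrally_degenerate d G" and "d > 0" and "D > 0"
    and A: "A \<subseteq> pverts G" "A \<noteq> {}" and W: "W \<subseteq> pverts G" "W \<inter> A = {}"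
    and F: "F \<subseteq> parcs G" "F \<subseteq> W \<times> A"
    and degW: "\<And>w. w \<in> W \<Longrightarrow> D \<le> 2 * real (card (F `` {w}))"
      "\<And>w. w \<in> W \<Longrightarrow> real (card (F `` {w})) \<le> D"
    and degA: "\<And>v. v \<in> A \<Longrightarrow> real (card (F\<inverse> `` {v})) \<le> D"
  shows "real (card F) \<le> 2 * d * real (card A)"
proof -
  interpret pair_graph G by fact
  have fin: "finite W" "finite A" "finite F"
    using A W F pair_finite_verts pair_finite_arcs finite_subset by metis+
  define c where "c = sqrt (d / D)"
  have c: "c > 0" "c\<^sup>2 = d / D" using \<open>d > 0\<close> \<open>D > 0\<close> by (simp_all add: c_def)
  have sqrt: "sqrt (d * D) = c * D"
    using \<open>d > 0\<close> \<open>D > 0\<close> by (simp add: c_def real_sqrt_divide real_sqrt_mult field_simps)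
  \<comment> \<open>These weights balance the two sides of the bipartite graph and give the factor 2.\<close>
  define x where "x v = (if v \<in> W then 1 else 2 * c)" for v
  have nW: "card W * D \<le> 2 * real (card F)"
  proof -
    have "card W * D = (\<Sum>w\<in>W. D)" by simp
    also have "\<dots> \<le> (\<Sum>w\<in>W. 2 * real (card (F `` {w})))" by (rule sum_mono) (rule degW)
    also have "\<dots> = 2 * real (card F)"
      using F fin by (subst card_rel_eq_sum_Image[of W F]) (auto simp: sum_distrib_left)
    finally show ?thesis .
  qed
  have "(\<Sum>(u, v)\<in>F \<union> F\<inverse>. x u * x v) \<le> sqrt (d * D) * (\<Sum>v\<in>W \<union> A. (x v)\<^sup>2)"
  proof (rule spectrally_degenerate_quadratic_form[OF G])
    show "F \<union> F\<inverse> \<subseteq> parcs G"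
      using F(1) pair_sym_arcs by (auto simp: symmetric_def sym_def)
    show "real (card ((F \<union> F\<inverse>) `` {v})) \<le> D" if "v \<in> W \<union> A" for v
    proof (cases "v \<in> W")
      case True
      then have "(F \<union> F\<inverse>) `` {v} = F `` {v}" using F W by auto
      then show ?thesis using degW True by simp
    next
      case False
      then have "(F \<union> F\<inverse>) `` {v} = F\<inverse> `` {v}" using F W by auto
      then show ?thesis using degA False that by simp
    qed
  qed (use \<open>d > 0\<close> A W F in \<open>auto simp: sym_def\<close>)
  also have "(\<Sum>(u, v)\<in>F \<union> F\<inverse>. x u * x v) = (\<Sum>(u, v)\<in>F \<union> F\<inverse>. 2 * c)"
  proof (rule sum.cong[OF refl], clarify)
    fix u v assume "(u, v) \<in> F \<union> F\<inverse>"
    then have "u \<in> W \<and> v \<notin> W \<or> v \<in> W \<and> u \<notin> W" using F(2) W(2) by blast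
    then show "x u * x v = 2 * c" by (auto simp: x_def)
  qed
  \<comment> \<open>Since \<open>W\<close> and \<open>A\<close> are disjoint, no arc lies in both
    orientations.\<close>
  also have "\<dots> = real (card F + card (F\<inverse>)) * (2 * c)"
    using F W fin by (subst card_Un_disjoint[symmetric]) auto
  also have "\<dots> = 4 * c * card F" by simp
  also have "(\<Sum>v\<in>W \<union> A. (x v)\<^sup>2) = (\<Sum>v\<in>W. 1) + (\<Sum>v\<in>A. (2 * c)\<^sup>2)"
    unfolding sum.union_disjoint[OF fin(1,2) W(2)]
    by (intro arg_cong2[of _ _ _ _ "(+)"] sum.cong refl) (use W in \<open>auto simp: x_def\<close>)
  also have "\<dots> = card W + 4 * (d / D) * card A" by (simp add: power_mult_distrib c)
  also have "sqrt (d * D) * \<dots> = c * (card W * D + 4 * d * card A)"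
    using \<open>D > 0\<close> unfolding sqrt by (simp add: field_simps)
  finally have "c * (4 * card F) \<le> c * (card W * D + 4 * d * card A)"
    by (simp add: mult_ac)
  then have "4 * real (card F) \<le> card W * D + 4 * d * card A"
    using c(1) by (simp add: mult_le_cancel_left_pos)
  with nW show ?thesis by simp
qed

text \<open>The half-open intervals abut, so if \<open>n\<close> exceeds \<open>2 ^ k * m\<close> it
  lies in the last one, and otherwise induction applies.\<close>

lemma ex_dyadic_interval:
  fixes m n k :: nat
  assumes "m < n" "n \<le> 2 ^ k * m"
  shows "\<exists>i<k. 2 ^ i * m < n \<and> n \<le> 2 ^ Suc i * m"
  using assms(2)
proof (induction k)
  case 0
  then show ?case using assms(1) by simp
next
  case (Suc k)
  then show ?case
    by (cases "n \<le> 2 ^ k * m") (auto intro: less_SucI)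
qed

section \<open>Edge-minimal subgraphs of given minimum degree\<close>

text \<open>In a choice with fewest arcs, an edge whose two ends in \<open>V\<close> both have
  degree above \<open>m\<close> could still be deleted.\<close>

lemma edge_minimal_symmetric_subrelation:
  fixes m :: nat
  assumes R: "finite R" "sym R" "irrefl R" and deg: "\<And>v. v \<in> V \<Longrightarrow> m \<le> card (R `` {v})"
  obtains E where "E \<subseteq> R" "sym E" "\<And>v. v \<in> V \<Longrightarrow> m \<le> card (E `` {v})"
    "\<And>u v. (u, v) \<in> E \<Longrightarrow> u \<in> V \<Longrightarrow> v \<in> V \<Longrightarrow> card (E `` {u}) = m \<or> card (E `` {v}) = m"
proof -
  define P where "P E \<longleftrightarrow> E \<subseteq> R \<and> sym E \<and> (\<forall>v\<in>V. m \<le> card (E `` {v}))" for E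
  have "P R" using R deg by (simp add: P_def)
  then obtain E where E: "P E" and min: "\<And>E'. P E' \<Longrightarrow> card E \<le> card E'"
    using ex_has_least_nat[of P R card] by blast
  have finE: "finite E" using E R finite_subset by (auto simp: P_def)
  have "card (E `` {u}) = m \<or> card (E `` {v}) = m" if uv: "(u, v) \<in> E" "u \<in> V" "v \<in> V" for u v
  proof (rule ccontr)
    assume "\<not> ?thesis"
    then have gt: "m < card (E `` {u})" "m < card (E `` {v})"
      using E uv by (force simp: P_def)+
    have ne: "u \<noteq> v" using uv(1) E R(3) by (auto simp: P_def irrefl_def)
    have vu: "(v, u) \<in> E" using uv(1) E by (auto simp: P_def sym_def)
    \<comment> \<open>Removing both arcs keeps the relation symmetric; as
      \<open>u \<noteq> v\<close>, each end loses exactly one neighbour.\<close>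
    define E' where "E' = E - {(u, v), (v, u)}"
    have "m \<le> card (E' `` {w})" if "w \<in> V" for w
    proof -
      consider "w = u" | "w = v" | "w \<noteq> u" "w \<noteq> v" by blast
      then show ?thesis
      proof cases
        case 1
        then have "E' `` {w} = E `` {u} - {v}" using ne by (auto simp: E'_def)
        then show ?thesis using gt uv(1) by (simp add: card_Diff_singleton)
      next
        case 2
        then have "E' `` {w} = E `` {v} - {u}" using ne by (auto simp: E'_def)
        then show ?thesis using gt vu by (simp add: card_Diff_singleton)
      next
        case 3
        then have "E' `` {w} = E `` {w}" by (auto simp: E'_def)
        then show ?thesis using E that by (simp add: P_def)
      qed
    qed
    then have "P E'" using E by (auto simp: P_def E'_def sym_def)
    moreover have "card E' < card E"
      unfolding E'_def using uv(1) by (intro psubset_card_mono finE) auto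
    ultimately show False using min by fastforce
  qed
  then show ?thesis using that E by (auto simp: P_def)
qed

section \<open>Counting arcs at the vertices of degree exactly \<open>m\<close>\<close>

lemma spectrally_degenerate_min_degree:
  fixes m k :: nat
  assumes G: "pair_graph G" "spectrally_degenerate d G" and ne: "pverts G \<noteq> {}"
    and "d > 0" and m: "4 * d < m"
    and min: "\<And>v. v \<in> pverts G \<Longrightarrow> m \<le> degree_of G v"
    and max: "\<And>v. v \<in> pverts G \<Longrightarrow> degree_of G v \<le> 2 ^ k * m"
  shows "real m \<le> 4 * d * k"
proof -
  interpret pair_graph G by fact
  let ?V = "pverts G"
  have m0: "m > 0" using m \<open>d > 0\<close> by (cases m) auto
  obtain E where E: "E \<subseteq> parcs G" "sym E"
    and Emin: "\<And>v. v \<in> ?V \<Longrightarrow> m \<le> card (E `` {v})"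
    and tight: "\<And>u v. (u, v) \<in> E \<Longrightarrow> u \<in> ?V \<Longrightarrow> v \<in> ?V \<Longrightarrow> card (E `` {u}) = m \<or> card (E `` {v}) = m"
  proof (rule edge_minimal_symmetric_subrelation[of "parcs G" ?V m])
    show "sym (parcs G)" using pair_sym_arcs by (simp add: symmetric_def)
    show "irrefl (parcs G)" using pair_no_loops by (force simp: irrefl_def)
    show "m \<le> card (parcs G `` {v})" if "v \<in> ?V" for v
      using min[OF that] by (simp add: degree_of_eq_card_Image)
  qed (use pair_finite_arcs in auto)
  have EV: "u \<in> ?V" "v \<in> ?V" if "(u, v) \<in> E" for u v
    using that E(1) in_arcsD1 in_arcsD2 by blast+
  have finE: "finite E" using E(1) pair_finite_arcs finite_subset by blast
  have Emax: "card (E `` {v}) \<le> 2 ^ k * m" if "v \<in> ?V" for v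
  proof -
    have "card (E `` {v}) \<le> card (parcs G `` {v})"
      using E(1) pair_finite_arcs by (intro card_mono) (auto simp: finite_Image)
    then show ?thesis using max[OF that] by (simp add: degree_of_eq_card_Image)
  qed
  define A where "A = {v \<in> ?V. card (E `` {v}) = m}"
  have A: "A \<subseteq> ?V" "finite A" using pair_finite_verts by (auto simp: A_def)
  have EA: "u \<in> A \<or> v \<in> A" if "(u, v) \<in> E" for u v
    using that tight[OF that] EV[OF that] by (auto simp: A_def)
  have "A \<noteq> {}"
  proof -
    obtain v where v: "v \<in> ?V" using ne by blast
    have "E `` {v} \<noteq> {}" using Emin[OF v] m0 by (metis card.empty not_less)
    then show ?thesis using EA by blast
  qed
  then have cA: "real (card A) > 0" using A by (simp add: card_gt_0_iff)

  \<comment> \<open>The test vector is constantly 1 on \<open>A\<close>, where degrees are at most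
    \<open>m\<close>.\<close>
  have AA: "real (card (E \<inter> A \<times> A)) \<le> sqrt (d * m) * card A"
  proof -
    have "(\<Sum>(u, v)\<in>E \<inter> A \<times> A. 1 * 1) \<le> sqrt (d * real m) * (\<Sum>v\<in>A. 1\<^sup>2)"
    proof (rule spectrally_degenerate_quadratic_form[OF G])
      show "real (card ((E \<inter> A \<times> A) `` {v})) \<le> real m" if "v \<in> A" for v
      proof -
        have "card ((E \<inter> A \<times> A) `` {v}) \<le> card (E `` {v})"
          by (intro card_mono finite_Image finE) auto
        then show ?thesis using that by (simp add: A_def)
      qed
    qed (use \<open>d > 0\<close> A \<open>A \<noteq> {}\<close> E in \<open>auto simp: sym_def\<close>)
    then show ?thesis by simp
  qed

  \<comment> \<open>Within a class, degrees lie between \<open>D / 2\<close> and \<open>D\<close>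
    for \<open>D = 2 ^ Suc i * m\<close>, as the bipartite bound requires.\<close>
  define W where "W i = {v \<in> ?V - A. 2 ^ i * m < card (E `` {v}) \<and> card (E `` {v}) \<le> 2 ^ Suc i * m}" for i
  define F where "F i = {(w, a) \<in> E. w \<in> W i}" for i
  have F_card: "real (card (F i)) \<le> 2 * d * card A" for i
  proof (rule spectrally_degenerate_bipartite_card[OF G \<open>d > 0\<close>])
    let ?D = "real (2 ^ Suc i * m)"
    show "?D > 0" using m0 by simp
    have img: "F i `` {w} = E `` {w}" if "w \<in> W i" for w
      using that by (auto simp: F_def)
    show "?D \<le> 2 * real (card (F i `` {w}))" if "w \<in> W i" for w
    proof -
      have "2 ^ Suc i * m \<le> 2 * card (E `` {w})" using that by (simp add: W_def)
      then have "?D \<le> real (2 * card (E `` {w}))" by (rule of_nat_mono)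
      then show ?thesis by (simp add: img[OF that])
    qed
    show "real (card (F i `` {w})) \<le> ?D" if "w \<in> W i" for w
      unfolding img[OF that] of_nat_le_iff using that by (simp add: W_def)
    show "real (card ((F i)\<inverse> `` {v})) \<le> ?D" if "v \<in> A" for v
    proof -
      have "card ((F i)\<inverse> `` {v}) \<le> card (E `` {v})"
        using E(2) by (intro card_mono finite_Image finE) (auto simp: F_def sym_def)
      also have "\<dots> \<le> 2 ^ Suc i * m" using that by (simp add: A_def)
      finally show ?thesis by (rule of_nat_mono)
    qed
    \<comment> \<open>No edge of \<open>E\<close> joins two vertices outside \<open>A\<close>, so
      every neighbour of a class vertex is in \<open>A\<close> and \<open>F i\<close> keeps its full
      degree.\<close>
    show "F i \<subseteq> W i \<times> A" using EA by (auto simp: F_def W_def)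
  qed (use A \<open>A \<noteq> {}\<close> E in \<open>auto simp: F_def W_def\<close>)

  \<comment> \<open>A head outside \<open>A\<close> has degree above \<open>m\<close>, hence belongs
    to one of the \<open>k\<close> classes. The converse appears because \<open>F i\<close> is
    oriented from the class to \<open>A\<close>.\<close>
  have "E - ?V \<times> A \<subseteq> (\<Union>i<k. (F i)\<inverse>)"
  proof (rule subrelI)
    fix u v assume "(u, v) \<in> E - ?V \<times> A"
    then have uv: "(u, v) \<in> E" "(u, v) \<notin> ?V \<times> A" by blast+
    then have v: "v \<in> ?V - A" using EV by blast
    then have "m < card (E `` {v})" using Emin[of v] by (auto simp: A_def)
    then obtain i where "i < k" "v \<in> W i"
      using ex_dyadic_interval[OF _ Emax] v by (auto simp: W_def)
    moreover have "(v, u) \<in> E" using uv E(2) by (auto simp: sym_def)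
    ultimately show "(u, v) \<in> (\<Union>i<k. (F i)\<inverse>)" by (auto simp: F_def)
  qed
  then have sub: "E \<inter> A \<times> ?V \<subseteq> (E \<inter> A \<times> A) \<union> (\<Union>i<k. (F i)\<inverse>)" by blast
  have finF: "finite (F i)" for i
    by (rule finite_subset[OF _ finE]) (auto simp: F_def)
  have "m * card A = (\<Sum>v\<in>A. card (E `` {v}))" by (simp add: A_def)
  also have "\<dots> = (\<Sum>v\<in>A. card ((E \<inter> A \<times> ?V) `` {v}))"
    by (intro sum.cong refl arg_cong[of _ _ card]) (use EV in auto)
  also have "\<dots> = card (E \<inter> A \<times> ?V)"
    by (rule card_rel_eq_sum_Image[symmetric]) (use A finE in auto)
  also have "\<dots> \<le> card ((E \<inter> A \<times> A) \<union> (\<Union>i<k. (F i)\<inverse>))"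
    by (rule card_mono[OF _ sub]) (use finE finF in auto)
  also have "\<dots> \<le> card (E \<inter> A \<times> A) + (\<Sum>i<k. card (F i))"
    using card_UN_le[of "{..<k}" "\<lambda>i. (F i)\<inverse>"] card_Un_le[of "E \<inter> A \<times> A" "\<Union>i<k. (F i)\<inverse>"] by simp
  finally have "real m * card A \<le> card (E \<inter> A \<times> A) + (\<Sum>i<k. real (card (F i)))"
    by (simp flip: of_nat_mult of_nat_add of_nat_sum)
  also have "\<dots> \<le> sqrt (d * m) * card A + (\<Sum>i<k. 2 * d * card A)"
    by (intro add_mono AA sum_mono F_card)
  also have "\<dots> = (sqrt (d * m) + 2 * d * k) * card A" by (simp add: algebra_simps)
  finally have "real m \<le> sqrt (d * m) + 2 * d * k"
    using cA by simp
  \<comment> \<open>Here \<open>4 * d < m\<close> enters: it gives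
    \<open>d * m \<le> (m / 2)\<^sup>2\<close>, so the arcs inside \<open>A\<close> account for at
    most half of \<open>m\<close>.\<close>
  moreover have "sqrt (d * m) \<le> m / 2"
  proof (rule real_le_lsqrt)
    show "d * m \<le> (real m / 2)\<^sup>2"
      using mult_right_mono[of "4 * d" m m] m by (simp add: power2_eq_square field_simps)
  qed (use \<open>d > 0\<close> in auto)
  ultimately show ?thesis by simp
qed

section \<open>Choice of \<open>m\<close> and of the number of dyadic classes\<close>

theorem theorem1p3:
  fixes d :: real and G :: "'a pair_pre_digraph"
  assumes "d > 0"
    and "pair_graph G"
    and "pverts G \<noteq> {}"
    and "spectrally_degenerate d G"
  shows "\<exists>v \<in> pverts G. real (degree_of G v) \<le>
    (if max_degree G = 0 then 4 * d
     else max (4 * d) (4 * d * log 2 (real (max_degree G) / d)))"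
proof (rule ccontr)
  interpret pair_graph G by fact
  define \<Delta> where "\<Delta> = max_degree G"
  define b where "b = (if \<Delta> = 0 then 4 * d else max (4 * d) (4 * d * log 2 (real \<Delta> / d)))"
  assume "\<not> ?thesis"
  then have deg: "b < real (degree_of G v)" if "v \<in> pverts G" for v
    using that by (auto simp: b_def \<Delta>_def not_le)
  have b: "4 * d \<le> b" by (simp add: b_def)
  have le\<Delta>: "degree_of G v \<le> \<Delta>" if "v \<in> pverts G" for v
    unfolding \<Delta>_def max_degree_def using that pair_finite_verts by simp
  obtain v where v: "v \<in> pverts G" using assms(3) by blast
  have "0 < real (degree_of G v)" using deg[OF v] b assms(1) by linarith
  then have \<Delta>0: "\<Delta> > 0" using le\<Delta>[OF v] by linarith
  \<comment> \<open>The least integer strictly above \<open>b\<close>; since \<open>b > 0\<close>,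
    the conversion by \<open>nat\<close> does not truncate.\<close>
  define m where "m = nat (\<lfloor>b\<rfloor> + 1)"
  have m: "b < m" "\<And>n. b < real n \<Longrightarrow> m \<le> n"
    using b assms(1) unfolding m_def by linarith+
  have m0: "m > 0" using m(1) b assms(1) by (cases m) auto
  \<comment> \<open>A crude exponent suffices to show that the minimum defining \<open>k\<close>
    exists.\<close>
  have "\<Delta> \<le> 2 ^ \<Delta> * m"
    using m0 less_exp[of \<Delta>] by (metis less_imp_le_nat mult.right_neutral mult_le_mono Suc_leI One_nat_def)
  define k where "k = (LEAST k. \<Delta> \<le> 2 ^ k * m)"
  have k: "\<Delta> \<le> 2 ^ k * m" unfolding k_def by (rule LeastI) fact
  have mk: "real m \<le> 4 * d * k"
    by (rule spectrally_degenerate_min_degree[OF assms(2,4,3,1)])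
      (use m b deg le\<Delta> k in \<open>force intro: order_trans\<close>)+
  then have "k > 0" using m0 by (cases k) auto
  then obtain j where j: "k = Suc j" by (cases k) auto
  \<comment> \<open>Minimality of \<open>k\<close> bounds it from above:
    \<open>2 ^ j * m < \<Delta>\<close> with \<open>j = k - 1\<close>, and the constant in
    \<open>m > 4 * d\<close> makes up for the lost factor 2.\<close>
  have "\<not> \<Delta> \<le> 2 ^ j * m" using not_less_Least[of j "\<lambda>k. \<Delta> \<le> 2 ^ k * m"] j unfolding k_def by simp
  then have "real (2 ^ j * m) < real \<Delta>" by (simp only: of_nat_less_iff not_le)
  moreover have "2 ^ j * (4 * d) < 2 ^ j * real m" using m b by simp
  ultimately have "2 ^ j * (4 * d) < real \<Delta>"
    by (metis of_nat_mult of_nat_numeral of_nat_power order.strict_trans)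
  then have "2 ^ k < real \<Delta> / d"
    using assms(1) by (simp add: j field_simps)
  then have "real k < log 2 (real \<Delta> / d)"
    using \<Delta>0 assms(1) by (subst less_log_iff) (auto simp: powr_realpow)
  then have "4 * d * k < 4 * d * log 2 (real \<Delta> / d)" using assms(1) by simp
  \<comment> \<open>As \<open>\<Delta> > 0\<close>, \<open>b\<close> is the maximum containing the
    logarithm; then \<open>m \<le> 4 * d * k < b < m\<close> is absurd.\<close>
  also have "\<dots> \<le> b" using \<Delta>0 by (simp add: b_def)
  finally show False using mk m(1) by linarith
qed

end
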